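(* Let $X$ be a compact metric space, $\lambda$ a Borel probability measure on $X$, and $\mathbf x=(x_n)_{n\in\mathbb N}$ a sequence in $X$ with $\mathbf x\approx\lambda$. Let $(\mathbf I,\mathbf m)$ be admissible. Then $M(\mathbf x\mathbf n)\subseteq M(\lambda,\mathbf I,\mathbf m)$ for all $\mathbf n\in S(\mathbf I,\mathbf m)$.
   Context: $\mathbb N=\{1,2,\ldots\}$. $\mathcal M(X)$ is the set of Borel probability measures on $X$ with the topology of weak convergence, and $\mathcal P=\mathcal M([0,1])$. For a sequence $(y_n)$ in a compact metric space, $A((y_n))=\bigcap_{n_0\ge1}\overline{\{y_n:n\ge n_0\}}$ is its set of accumulation points. For a sequence $\mathbf x=(x_n)_{n\in\mathbb N}$ in $X$: $\mu_{\mathbf x,N}=\frac1N\sum_{n=1}^N\delta_{x_n}$, and $M(\mathbf x)=A((\mu_{\mathbf x,N})_{N\in\mathbb N})\subseteq\mathcal M(X)$. Let $\sigma$ denote the shift, $\sigma((x_n)_{n})=(x_{n+1})_{n}$. $\mathbf x\approx\lambda$ ($\mathbf x$ is well distributed with respect to $\lambda$) means $\lim_{N\to\infty}\mu_{\sigma^k(\mathbf x),N}=\lambda$ uniformly in $k\in\mathbb N$. $S_0$ is the set of strictly increasing sequences $\mathbf n=(n_k)_{k\in\mathbb N}$ of positive integers; $\mathbf x\mathbf n=(x_{n_k})_{k\in\mathbb N}$. $\mathbf I=(I_j)_{j\in\mathbb N}$ is a partition of $\mathbb N$ into intervals $I_j=\{n\in\mathbb N:a_{j-1}<n\le a_j\}$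 with integers $0=a_0<a_1<a_2<\cdots$, and $b_j=a_j-a_{j-1}$. $\mathbf m=(m_j)_{j\in\mathbb N}$ is a sequence of nonnegative integers with $m_j\le b_j$, $M_k=\sum_{j=1}^k m_j$, and $q_j=m_j/b_j\in[0,1]$. $(\mathbf I,\mathbf m)$ is admissible if $\lim_{j\to\infty}b_j=\infty$ and $\lim_{n\to\infty}m_n/M_n=0$. $S(\mathbf I,\mathbf m)$ is the set of those $\mathbf n\in S_0$ such that for each $j$ exactly $m_j$ of the members of $\mathbf n$ lie in $I_j$. $\pi_{\mathbf I,\mathbf m,N}=M_N^{-1}\sum_{j=1}^N m_j\delta_{q_j}\in\mathcal P$ (for $N$ with $M_N>0$), and $P(\mathbf I,\mathbf m)=A((\pi_{\mathbf I,\mathbf m,N})_{N})\subseteq\mathcal P$. For $\pi\in\mathcal P$ define $F_\pi:[0,1]\to[0,1]$ by $F_\pi(t_0)=\pi([0,t_0])+t_0\int_{(t_0,1]}\frac{d\pi(t)}{t}$ (in particular $F_\pi(0)=\pi(\{0\})$). Put $M(\pi,\lambda)=\{\mu\in\mathcal M(X):\mu\le F_\pi\circ\lambda\}$, i.e. $\mu(B)\le F_\pi(\lambda(B))$ for all Borel $B\subseteq X$, and $M(\lambda,\mathbf I,\mathbf m)=\bigcup_{\pi\in P(\mathbf I,\mathbf m)}M(\pi,\lambda)$. *)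

theory Defs
  imports "HOL-Probability.Probability"
begin

text \<open>
  All sequences are indexed by the positive integers: a sequence is a function on
  \<^typ>\<open>nat\<close> whose value at \<open>0\<close> is never used. The only exception is the sequence \<open>a\<close> of right
  end points of a partition into intervals, where \<open>a 0 = 0\<close> is meaningful.
  Spaces are subsets \<open>X\<close> of a metric space type, so that the same notions serve for the
  ambient compact space and for the real interval \<open>{0..1}\<close>.
\<close>

section \<open>Borel probability measures and the topology of weak convergence\<close>

abbreviation borel_on :: "'a::topological_space set \<Rightarrow> 'a measure" where
  "borel_on X \<equiv> restrict_space borel X"

definition prob_measures :: "'a::topological_space set \<Rightarrow> 'a measure set" where
  "prob_measures X = {\<mu>. prob_space \<mu> \<and> sets \<mu> = sets (borel_on X)}"

text \<open>The coarsest topology on \<open>prob_measures X\<close> making \<open>\<mu> \<mapsto> \<integral>f d\<mu>\<close> continuous for all bounded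
  continuous real-valued \<open>f\<close> on \<open>X\<close>.\<close>

definition weak_topology :: "'a::topological_space set \<Rightarrow> 'a measure topology" where
  "weak_topology X = topology_generated_by
     {{\<mu> \<in> prob_measures X. integral\<^sup>L \<mu> f \<in> U} | f U.
        continuous_on X (f :: 'a \<Rightarrow> real) \<and> bounded (f ` X) \<and> open U}"

text \<open>Accumulation points of a family indexed by a set \<open>J\<close> of positive integers; \<open>J\<close> allows for
  sequences of which finitely many terms are undefined.\<close>

definition accumulation_points :: "'b topology \<Rightarrow> nat set \<Rightarrow> (nat \<Rightarrow> 'b) \<Rightarrow> 'b set" where
  "accumulation_points T J y = (\<Inter>n\<^sub>0\<in>{1..}. T closure_of (y ` {n \<in> J. n\<^sub>0 \<le> n}))"

text \<open>The measure \<open>\<Sum>n\<in>J. w n * \<delta>\<^bsub>p n\<^esub>\<close> on \<open>X\<close>.\<close>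

definition dirac_combination ::
    "'a::topological_space set \<Rightarrow> nat set \<Rightarrow> (nat \<Rightarrow> real) \<Rightarrow> (nat \<Rightarrow> 'a) \<Rightarrow> 'a measure" where
  "dirac_combination X J w p =
     measure_of X (sets (borel_on X))
       (\<lambda>B. \<Sum>n\<in>J. ennreal (w n) * emeasure (return (borel_on X) (p n)) B)"

definition empirical_measure ::
    "'a::topological_space set \<Rightarrow> (nat \<Rightarrow> 'a) \<Rightarrow> nat \<Rightarrow> 'a measure" where
  "empirical_measure X x N = dirac_combination X {1..N} (\<lambda>n. 1 / real N) x"

definition limit_measures :: "'a::topological_space set \<Rightarrow> (nat \<Rightarrow> 'a) \<Rightarrow> 'a measure set" where
  "limit_measures X x = accumulation_points (weak_topology X) {1..} (empirical_measure X x)"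

definition shift :: "(nat \<Rightarrow> 'a) \<Rightarrow> nat \<Rightarrow> 'a" where
  "shift x = (\<lambda>n. x (n + 1))"

text \<open>Since the limit does not depend on \<open>k\<close>, uniform convergence in \<open>k\<close> only involves the
  neighbourhoods of the limit.\<close>

definition well_distributed ::
    "'a::topological_space set \<Rightarrow> (nat \<Rightarrow> 'a) \<Rightarrow> 'a measure \<Rightarrow> bool" where
  "well_distributed X x lam \<longleftrightarrow>
     (\<forall>U. openin (weak_topology X) U \<and> lam \<in> U \<longrightarrow>
        (\<exists>N\<^sub>0. \<forall>N\<ge>N\<^sub>0. \<forall>k\<ge>1. empirical_measure X ((shift ^^ k) x) N \<in> U))"

section \<open>Subsequences with prescribed numbers of members in intervals\<close>

definition increasing_index_seqs :: "(nat \<Rightarrow> nat) set" where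
  "increasing_index_seqs = {n. strict_mono_on {1..} n \<and> (\<forall>k\<ge>1. 1 \<le> n k)}"

text \<open>A partition of the positive integers into intervals is represented by the sequence \<open>a\<close> of
  right end points; its members are \<open>block a j\<close> for \<open>j \<ge> 1\<close>.\<close>

definition interval_partition :: "(nat \<Rightarrow> nat) \<Rightarrow> bool" where
  "interval_partition a \<longleftrightarrow> a 0 = 0 \<and> strict_mono a"

definition block :: "(nat \<Rightarrow> nat) \<Rightarrow> nat \<Rightarrow> nat set" where
  "block a j = {n. a (j - 1) < n \<and> n \<le> a j}"

definition block_length :: "(nat \<Rightarrow> nat) \<Rightarrow> nat \<Rightarrow> nat" where
  "block_length a j = a j - a (j - 1)"

definition total :: "(nat \<Rightarrow> nat) \<Rightarrow> nat \<Rightarrow> nat" where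
  "total m k = (\<Sum>j=1..k. m j)"

definition ratio :: "(nat \<Rightarrow> nat) \<Rightarrow> (nat \<Rightarrow> nat) \<Rightarrow> nat \<Rightarrow> real" where
  "ratio a m j = real (m j) / real (block_length a j)"

text \<open>The limit of the quotients \<open>m n / total m n\<close> presupposes that they are eventually defined;
  this is made explicit because division by zero yields zero.\<close>

definition admissible :: "(nat \<Rightarrow> nat) \<Rightarrow> (nat \<Rightarrow> nat) \<Rightarrow> bool" where
  "admissible a m \<longleftrightarrow>
     interval_partition a \<and>
     (\<forall>j\<ge>1. m j \<le> block_length a j) \<and>
     filterlim (block_length a) at_top sequentially \<and>
     (\<forall>\<^sub>F n in sequentially. total m n > 0) \<and>
     (\<lambda>n. real (m n) / real (total m n)) \<longlonglongrightarrow> 0"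

definition prescribed_seqs :: "(nat \<Rightarrow> nat) \<Rightarrow> (nat \<Rightarrow> nat) \<Rightarrow> (nat \<Rightarrow> nat) set" where
  "prescribed_seqs a m =
     {n \<in> increasing_index_seqs. \<forall>j\<ge>1. card (n ` {1..} \<inter> block a j) = m j}"

section \<open>Limit distributions of the ratios and the dominated measures\<close>

definition ratio_measure :: "(nat \<Rightarrow> nat) \<Rightarrow> (nat \<Rightarrow> nat) \<Rightarrow> nat \<Rightarrow> real measure" where
  "ratio_measure a m N =
     dirac_combination {0..1} {1..N} (\<lambda>j. real (m j) / real (total m N)) (ratio a m)"

definition limit_ratio_measures :: "(nat \<Rightarrow> nat) \<Rightarrow> (nat \<Rightarrow> nat) \<Rightarrow> real measure set" where
  "limit_ratio_measures a m =
     accumulation_points (weak_topology {0..1}) {N. N \<ge> 1 \<and> total m N > 0} (ratio_measure a m)"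

text \<open>For \<open>t\<^sub>0 = 0\<close> the second summand is zero, whether or not \<open>1 / t\<close> is integrable.\<close>

definition F :: "real measure \<Rightarrow> real \<Rightarrow> real" where
  "F \<pi> t\<^sub>0 = measure \<pi> {0..t\<^sub>0} + t\<^sub>0 * (LINT t:{t\<^sub>0<..1}|\<pi>. 1 / t)"

definition dominated_measures ::
    "'a::topological_space set \<Rightarrow> real measure \<Rightarrow> 'a measure \<Rightarrow> 'a measure set" where
  "dominated_measures X \<pi> lam =
     {\<mu> \<in> prob_measures X. \<forall>B\<in>sets (borel_on X). measure \<mu> B \<le> F \<pi> (measure lam B)}"

definition admissible_limit_measures ::
    "'a::topological_space set \<Rightarrow> 'a measure \<Rightarrow> (nat \<Rightarrow> nat) \<Rightarrow> (nat \<Rightarrow> nat) \<Rightarrow> 'a measure set" where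
  "admissible_limit_measures X lam a m =
     (\<Union>\<pi>\<in>limit_ratio_measures a m. dominated_measures X \<pi> lam)"

section \<open>Basic facts\<close>

lemma topspace_weak_topology: "topspace (weak_topology X) = prob_measures X"
proof -
  have "\<exists>f U. prob_measures X = {\<mu> \<in> prob_measures X. integral\<^sup>L \<mu> f \<in> U} \<and>
      continuous_on X (f :: 'a \<Rightarrow> real) \<and> bounded (f ` X) \<and> open U"
    by (rule exI[of _ "\<lambda>_. 0"], rule exI[of _ UNIV]) (auto simp: image_constant_conv)
  then show ?thesis
    unfolding weak_topology_def topology_generated_by_topspace by blast
qed

lemma space_dirac_combination: "space (dirac_combination X J w p) = X"
  and sets_dirac_combination: "sets (dirac_combination X J w p) = sets (borel_on X)"
proof -
  have sub: "sets (borel_on X) \<subseteq> Pow X"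
    using sets.space_closed[of "borel_on X"] by (simp add: space_restrict_space)
  show "space (dirac_combination X J w p) = X"
    unfolding dirac_combination_def using sub by (rule space_measure_of)
  have "sigma_sets X (sets (borel_on X)) = sets (borel_on X)"
    using sets.sigma_sets_eq[of "borel_on X"] by (simp add: space_restrict_space)
  then show "sets (dirac_combination X J w p) = sets (borel_on X)"
    unfolding dirac_combination_def using sub by simp
qed

lemma emeasure_dirac_combination:
  assumes "B \<in> sets (borel_on X)"
  shows "emeasure (dirac_combination X J w p) B = (\<Sum>n\<in>J. ennreal (w n) * indicator B (p n))"
proof -
  let ?f = "\<lambda>B. \<Sum>n\<in>J. ennreal (w n) * emeasure (return (borel_on X) (p n)) B"
  have "countably_additive (sets (borel_on X)) ?f"
  proof (rule countably_additiveI)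
    fix A :: "nat \<Rightarrow> 'a set"
    assume A: "range A \<subseteq> sets (borel_on X)" "disjoint_family A"
    have "(\<Sum>i. ?f (A i)) = (\<Sum>n\<in>J. \<Sum>i. ennreal (w n) * emeasure (return (borel_on X) (p n)) (A i))"
      by (subst suminf_sum) auto
    also have "\<dots> = ?f (\<Union> (range A))"
      using A by (simp add: suminf_emeasure del: emeasure_return)
    finally show "(\<Sum>i. ?f (A i)) = ?f (\<Union> (range A))" .
  qed
  then have "emeasure (dirac_combination X J w p) B = ?f B"
    using assms sets_dirac_combination[of X J w p] sets.space_closed[of "borel_on X"]
    by (intro emeasure_measure_of[OF dirac_combination_def])
       (auto simp: positive_def space_restrict_space)
  then show ?thesis
    using assms by simp
qed

end

theory Submission
  imports Defs
begin

text \<open>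
  Let \<open>0 \<le> f \<le> 1\<close> be continuous on \<open>X\<close> and \<open>s > \<integral>f d\<lambda>\<close>. The members of \<open>n\<close> in a late block \<open>j\<close> contribute
  at most \<open>m j\<close> to \<open>\<Sum>f(x (n k))\<close>, because \<open>f \<le> 1\<close>, and at most \<open>s b\<^sub>j\<close>, because \<open>x\<close> is well
  distributed. Hence the contribution is at most \<open>m j * min 1 (s / q\<^sub>j)\<close>, and averaging over the blocks
  bounds \<open>\<integral>f d\<mu>\<close> by \<open>\<integral>min 1 (s / t) d\<pi>(t) = F \<pi> s\<close> along any sequence of indices on which the
  empirical measures tend to \<open>\<mu>\<close> and the ratio measures tend to some \<open>\<pi>\<close>; the latter can be
  arranged by Helly's theorem. Letting \<open>f\<close> decrease to the indicator of a closed set and using inner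
  regularity of \<open>\<mu>\<close> gives \<open>\<mu> B \<le> F \<pi> s\<close> for all \<open>s > \<lambda> B\<close>, and \<open>s\<close> tends to \<open>\<lambda> B\<close>.
  Since \<open>\<pi>\<close> must not depend on \<open>f\<close>, only countably many functions \<open>f\<close> are used.
\<close>

section \<open>Borel measures on metric spaces\<close>

text \<open>Regularity of finite Borel measures: the sets that can be squeezed between a closed and
  an open set with small difference contain the closed sets, which are intersections of their
  shrinking neighbourhoods, and are stable under complements and countable unions. The two-sided
  form is what makes the complement step symmetric.\<close>

lemma ex_closed_open_approximation:
  fixes M :: "'a::metric_space measure"
  assumes "finite_measure M" and sets_M: "sets M = sets borel" and "B \<in> sets borel" and "0 < e"
  shows "\<exists>C U. closed C \<and> open U \<and> C \<subseteq> B \<and> B \<subseteq> U \<and> measure M (U - C) < e"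
proof -
  interpret finite_measure M by fact
  have [measurable]: "closed S \<Longrightarrow> S \<in> sets M" "open S \<Longrightarrow> S \<in> sets M" for S
    using sets_M by auto
  have "B \<in> sigma_sets UNIV (Collect closed)"
    using \<open>B \<in> sets borel\<close> unfolding borel_eq_closed by simp
  then show ?thesis using \<open>0 < e\<close>
  proof (induction arbitrary: e)
    case (Basic S)
    then have "closed S" by simp
    \<comment> \<open>The empty set is treated apart because \<open>infdist x {}\<close> is 0 by
      convention, so that every \<open>U n\<close> would be the whole space.\<close>
    show ?case
    proof (cases "S = {}")
      case True
      then show ?thesis using Basic by (intro exI[of _ "{}"]) auto
    next
      case False
      define U where "U n = {x. infdist x S < 1 / real (Suc n)}" for n
      have open_U: "open (U n)" for n
        unfolding U_def by (intro open_Collect_less continuous_intros)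
      have "S \<subseteq> U n" for n by (auto simp: U_def)
      have "decseq U"
        by (auto simp: decseq_def U_def elim!: less_le_trans intro!: divide_left_mono)
      have "(\<Inter>n. U n) = S"
      proof
        show "(\<Inter>n. U n) \<subseteq> S"
        proof
          fix x assume x: "x \<in> (\<Inter>n. U n)"
          have "infdist x S \<le> 0"
          proof (rule ccontr)
            assume "\<not> infdist x S \<le> 0"
            then obtain n where "1 / real (Suc n) < infdist x S"
              using reals_Archimedean[of "infdist x S"] by (auto simp: inverse_eq_divide)
            with x show False by (auto simp: U_def dest!: spec[of _ n])
          qed
          then show "x \<in> S"
            using \<open>closed S\<close> False in_closed_iff_infdist_zero infdist_nonneg[of x S] by fastforce
        qed
      qed (use \<open>\<And>n. S \<subseteq> U n\<close> in auto)
      moreover have "range U \<subseteq> sets M" using open_U by auto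
      ultimately have "(\<lambda>n. measure M (U n)) \<longlonglongrightarrow> measure M S"
        using finite_Lim_measure_decseq[of U] \<open>decseq U\<close> by simp
      then have "\<forall>\<^sub>F n in sequentially. measure M (U n) < measure M S + e"
        using Basic.prems by (intro order_tendstoD) auto
      then obtain n where "measure M (U n) < measure M S + e"
        by (auto simp: eventually_sequentially)
      moreover have "measure M (U n - S) = measure M (U n) - measure M S"
        using \<open>S \<subseteq> U n\<close> open_U \<open>closed S\<close> by (intro finite_measure_Diff) auto
      ultimately show ?thesis
        using \<open>closed S\<close> open_U[of n] \<open>S \<subseteq> U n\<close> by (intro exI[of _ S] exI[of _ "U n"]) auto
    qed
  next
    case Empty
    then show ?case by (intro exI[of _ "{}"]) auto
  next
    case (Compl A)
    obtain C U where "closed C" "open U" "C \<subseteq> A" "A \<subseteq> U" "measure M (U - C) < e"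
      using Compl.IH[OF Compl.prems] by blast
    moreover have "- C - - U = U - C" by auto
    ultimately show ?case
      by (intro exI[of _ "- U"] exI[of _ "- C"]) auto
  next
    case (Union A)
    have "\<exists>C U. closed C \<and> open U \<and> C \<subseteq> A i \<and> A i \<subseteq> U \<and> measure M (U - C) < e / 2 * (1 / 2) ^ Suc i" for i
      using Union.prems by (intro Union.IH) auto
    then obtain C U where CU: "\<And>i. closed (C i)" "\<And>i. open (U i)" "\<And>i. C i \<subseteq> A i" "\<And>i. A i \<subseteq> U i"
      "\<And>i. measure M (U i - C i) < e / 2 * (1 / 2) ^ Suc i" by metis
    \<comment> \<open>An infinite union of closed sets need not be closed, so only finitely many
      \<open>C i\<close> are kept. \<open>V n\<close> is what the open union has in excess of them;
      it decreases to a set of measure at most \<open>e / 2\<close>, so some \<open>V n\<close> has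
      measure below \<open>e\<close>.\<close>
    define V where "V n = \<Union>(range U) - (\<Union>i\<le>n. C i)" for n
    have geo: "(\<lambda>i. e / 2 * (1 / 2) ^ Suc i) sums (e / 2)"
      using sums_mult[OF power_half_series, of "e / 2"] by simp
    have summ: "summable (\<lambda>i. measure M (U i - C i))"
      by (rule summable_comparison_test'[OF sums_summable[OF geo]]) (use CU(5) in \<open>auto intro: less_imp_le\<close>)
    have "measure M (\<Inter>n. V n) \<le> measure M (\<Union>i. U i - C i)"
    proof (rule finite_measure_mono)
      show "(\<Inter>n. V n) \<subseteq> (\<Union>i. U i - C i)"
      proof
        fix x assume x: "x \<in> (\<Inter>n. V n)"
        then obtain i where "x \<in> U i" by (auto simp: V_def)
        moreover have "x \<notin> C i" using x by (auto simp: V_def dest!: spec[of _ i])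
        ultimately show "x \<in> (\<Union>i. U i - C i)" by blast
      qed
    qed (use CU in auto)
    also have "\<dots> \<le> (\<Sum>i. measure M (U i - C i))"
      using CU summ by (intro finite_measure_subadditive_countably) auto
    also have "\<dots> \<le> (\<Sum>i. e / 2 * (1 / 2) ^ Suc i)"
      using CU(5) summ sums_summable[OF geo] by (intro suminf_le) (auto intro: less_imp_le)
    also have "\<dots> < e" using sums_unique[OF geo] Union.prems by simp
    finally have less: "measure M (\<Inter>n. V n) < e" .
    have "(\<lambda>n. measure M (V n)) \<longlonglongrightarrow> measure M (\<Inter>n. V n)"
      using CU by (intro finite_Lim_measure_decseq) (auto simp: V_def decseq_def intro!: sets.Diff borel_closed)
    from order_tendstoD(2)[OF this less] obtain n where "measure M (V n) < e"
      by (auto simp: eventually_sequentially)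
    moreover have "closed (\<Union>i\<le>n. C i)" "open (\<Union>(range U))" using CU by auto
    ultimately show ?case
      using CU(3,4) unfolding V_def by (intro exI[of _ "\<Union>i\<le>n. C i"] exI[of _ "\<Union>(range U)"]) blast
  qed
qed

lemma prob_measuresD:
  assumes "\<mu> \<in> prob_measures X"
  shows "prob_space \<mu>" "sets \<mu> = sets (borel_on X)" "space \<mu> = X"
  using assms sets_eq_imp_space_eq[of \<mu> "borel_on X"]
  by (auto simp: prob_measures_def space_restrict_space)

text \<open>The measure is pushed forward along the inclusion of \<open>X\<close>, so that
  regularity on the whole type applies. As \<open>X\<close> is closed, Borel sets of
  \<open>X\<close> are Borel in the type.\<close>

lemma ex_closed_inner_approximation:
  fixes X :: "'a::metric_space set"
  assumes \<mu>: "\<mu> \<in> prob_measures X" and "closed X" and B: "B \<in> sets (borel_on X)" and "0 < e"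
  shows "\<exists>C. closed C \<and> C \<subseteq> B \<and> measure \<mu> B < measure \<mu> C + e"
proof -
  note \<mu>_simps = prob_measuresD[OF \<mu>]
  interpret prob_space \<mu> by (rule \<mu>_simps)
  define M where "M = distr \<mu> borel (\<lambda>x. x)"
  have id: "(\<lambda>x. x) \<in> \<mu> \<rightarrow>\<^sub>M borel"
    using measurable_restrict_space1[of "\<lambda>x. x" borel borel X]
    by (simp add: measurable_cong_sets[OF \<mu>_simps(2) refl])
  interpret M: finite_measure M unfolding M_def by (rule finite_measure_distr[OF id])
  have measure_M: "measure M A = measure \<mu> (A \<inter> X)" if "A \<in> sets borel" for A
    unfolding M_def using measure_distr[OF id that] \<mu>_simps by simp
  have B': "B \<in> sets borel" "B \<subseteq> X"
    using B \<open>closed X\<close> by (auto simp: sets_restrict_space_iff)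
  from ex_closed_open_approximation[OF M.finite_measure_axioms _ B'(1) \<open>0 < e\<close>]
  obtain C U where CU: "closed C" "open U" "C \<subseteq> B" "B \<subseteq> U" "measure M (U - C) < e"
    by (auto simp: M_def)
  have "measure M B - measure M C = measure M (B - C)"
    using CU B' by (intro M.finite_measure_Diff[symmetric]) (auto simp: M_def)
  also have "\<dots> \<le> measure M (U - C)"
    using CU by (intro M.finite_measure_mono) (auto simp: M_def)
  finally have "measure M B < measure M C + e" using CU(5) by simp
  moreover have "B \<inter> X = B" "C \<inter> X = C" using B' CU by auto
  ultimately show ?thesis using CU B' by (auto simp: measure_M)
qed

section \<open>Finite combinations of point masses\<close>

lemma dirac_combination_eq_distr:
  assumes "finite J" and "\<And>n. n \<in> J \<Longrightarrow> p n \<in> X" and "\<And>n. n \<in> J \<Longrightarrow> 0 \<le> w n"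
  shows "dirac_combination X J w p = distr (point_measure J w) (borel_on X) p"
proof (rule measure_eqI)
  fix B assume "B \<in> sets (dirac_combination X J w p)"
  then have B: "B \<in> sets (borel_on X)" by (simp add: sets_dirac_combination)
  have "emeasure (distr (point_measure J w) (borel_on X) p) B = emeasure (point_measure J w) (p -` B \<inter> J)"
    using assms B by (subst emeasure_distr) (auto simp: space_restrict_space space_point_measure)
  also have "\<dots> = (\<Sum>n\<in>p -` B \<inter> J. ennreal (w n))"
    using assms by (subst emeasure_point_measure_finite) auto
  also have "\<dots> = (\<Sum>n\<in>J. ennreal (w n) * indicator B (p n))"
    using assms(1) by (intro sum.mono_neutral_cong_left) (auto simp: indicator_def)
  finally show "emeasure (dirac_combination X J w p) B = emeasure (distr (point_measure J w) (borel_on X) p) B"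
    using emeasure_dirac_combination[OF B] by simp
qed (simp add: sets_dirac_combination)

text \<open>The combination is the image under \<open>p\<close> of a point measure on
  \<open>J\<close>, so a change of variables leaves a finite sum.\<close>

lemma integral_dirac_combination:
  fixes f :: "'a::topological_space \<Rightarrow> real"
  assumes "finite J" and "\<And>n. n \<in> J \<Longrightarrow> p n \<in> X" and "\<And>n. n \<in> J \<Longrightarrow> 0 \<le> w n" and "continuous_on X f"
  shows "integral\<^sup>L (dirac_combination X J w p) f = (\<Sum>n\<in>J. w n * f (p n))"
proof -
  have "integral\<^sup>L (dirac_combination X J w p) f = integral\<^sup>L (point_measure J w) (\<lambda>n. f (p n))"
    using assms borel_measurable_continuous_on_restrict[OF assms(4)]
    by (simp add: dirac_combination_eq_distr) (subst integral_distr, auto simp: space_restrict_space space_point_measure)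
  then show ?thesis
    using assms by (simp add: lebesgue_integral_point_measure_finite)
qed

lemma dirac_combination_in_prob_measures:
  assumes "finite J" and "\<And>n. n \<in> J \<Longrightarrow> p n \<in> X" and "\<And>n. n \<in> J \<Longrightarrow> 0 \<le> w n" and "(\<Sum>n\<in>J. w n) = 1"
  shows "dirac_combination X J w p \<in> prob_measures X"
proof -
  have X: "X \<in> sets (borel_on X)" using sets.top[of "borel_on X"] by (simp add: space_restrict_space)
  have "emeasure (dirac_combination X J w p) X = (\<Sum>n\<in>J. ennreal (w n))"
    using assms by (subst emeasure_dirac_combination[OF X]) (auto intro!: sum.cong)
  also have "\<dots> = 1" using assms by simp
  finally show ?thesis
    unfolding prob_measures_def
    by (auto intro!: prob_spaceI simp: space_dirac_combination sets_dirac_combination)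
qed

lemma integrable_continuous_bounded:
  fixes f :: "'a::topological_space \<Rightarrow> real"
  assumes "\<mu> \<in> prob_measures X" and "continuous_on X f" and "\<And>x. x \<in> X \<Longrightarrow> \<bar>f x\<bar> \<le> c"
  shows "integrable \<mu> f"
proof -
  interpret prob_space \<mu> using prob_measuresD[OF assms(1)] by simp
  have "f \<in> borel_measurable \<mu>"
    using borel_measurable_continuous_on_restrict[OF assms(2)]
    by (simp add: measurable_cong_sets[OF prob_measuresD(2)[OF assms(1)] refl])
  then show ?thesis
    using assms(3) prob_measuresD(3)[OF assms(1)] by (intro integrable_const_bound[of _ c]) auto
qed

section \<open>Weak neighbourhoods, accumulation points and convergent subsequences\<close>

lemma openin_weak_topology_ball:
  fixes f :: "'a::topological_space \<Rightarrow> real"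
  assumes "continuous_on X f" and "bounded (f ` X)"
  shows "openin (weak_topology X) {\<mu> \<in> prob_measures X. \<bar>integral\<^sup>L \<mu> f - c\<bar> < e}"
proof -
  have "{\<mu> \<in> prob_measures X. \<bar>integral\<^sup>L \<mu> f - c\<bar> < e} = {\<mu> \<in> prob_measures X. integral\<^sup>L \<mu> f \<in> ball c e}"
    by (auto simp: dist_real_def)
  then show ?thesis
    unfolding weak_topology_def using assms by (intro topology_generated_by_Basis) blast
qed

text \<open>Induction on the generation of the topology reduces the claim to a subbasic set, where
  it is convergence of a single integral. This places a limit of measures in the closures that
  define accumulation points.\<close>

lemma eventually_in_weak_open:
  assumes "openin (weak_topology X) U" and "\<pi> \<in> U" and "\<And>r. \<rho> r \<in> prob_measures X"
    and "\<And>f :: 'a::topological_space \<Rightarrow> real. continuous_on X f \<Longrightarrow> bounded (f ` X) \<Longrightarrow>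
      (\<lambda>r. integral\<^sup>L (\<rho> r) f) \<longlonglongrightarrow> integral\<^sup>L \<pi> f"
  shows "\<forall>\<^sub>F r in sequentially. \<rho> r \<in> U"
proof -
  have "generate_topology_on {{\<mu> \<in> prob_measures X. integral\<^sup>L \<mu> f \<in> U} | f U.
        continuous_on X (f :: 'a \<Rightarrow> real) \<and> bounded (f ` X) \<and> open U} U"
    using assms(1) unfolding weak_topology_def by (rule openin_topology_generated_by)
  then show ?thesis
    using \<open>\<pi> \<in> U\<close>
  proof induction
    case (Int U V)
    then show ?case by (auto intro: eventually_conj)
  next
    case (UN \<K>)
    then obtain V where V: "V \<in> \<K>" "\<pi> \<in> V" by blast
    then show ?case using UN.IH[OF V] by (auto elim: eventually_mono)
  next
    case (Basis V)
    then obtain f :: "'a \<Rightarrow> real" and W where V: "V = {\<mu> \<in> prob_measures X. integral\<^sup>L \<mu> f \<in> W}"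
      "continuous_on X f" "bounded (f ` X)" "open W" by blast
    then show ?case
      using topological_tendstoD[OF assms(4)[OF V(2,3)] V(4)] Basis assms(3) by auto
  qed simp
qed

text \<open>Accumulation points are given by closures, not by sequences. For countably many test
  functions a sequence still exists: the r-th index is taken from a neighbourhood that controls the
  functions up to number r with tolerance 1 / (r + 1).\<close>

lemma limit_measures_sequence:
  fixes T :: "nat \<Rightarrow> 'a::topological_space \<Rightarrow> real"
  assumes "\<mu> \<in> limit_measures X y" and "\<And>i. continuous_on X (T i)" and "\<And>i. bounded (T i ` X)"
  shows "\<exists>K. (\<forall>r. r < K r) \<and> (\<forall>i. (\<lambda>r. integral\<^sup>L (empirical_measure X y (K r)) (T i)) \<longlonglongrightarrow> integral\<^sup>L \<mu> (T i))"
proof -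
  have cl: "\<mu> \<in> weak_topology X closure_of (empirical_measure X y ` {n \<in> {1..}. Suc r \<le> n})" for r
    using assms(1) unfolding limit_measures_def accumulation_points_def by auto
  have \<mu>: "\<mu> \<in> prob_measures X"
    using cl[of 0] closure_of_subset_topspace[of "weak_topology X"] by (auto simp: topspace_weak_topology)
  define U where "U r = (\<Inter>i\<le>r. {\<nu> \<in> prob_measures X. \<bar>integral\<^sup>L \<nu> (T i) - integral\<^sup>L \<mu> (T i)\<bar> < 1 / real (Suc r)})" for r
  have "openin (weak_topology X) (U r)" for r
    unfolding U_def using assms by (intro openin_INT2 openin_weak_topology_ball) auto
  moreover have "\<mu> \<in> U r" for r using \<mu> by (auto simp: U_def)
  ultimately have "\<exists>K\<ge>Suc r. empirical_measure X y K \<in> U r" for r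
    using cl[of r] unfolding in_closure_of by blast
  then obtain K where K: "\<And>r. Suc r \<le> K r" "\<And>r. empirical_measure X y (K r) \<in> U r" by metis
  have "(\<lambda>r. integral\<^sup>L (empirical_measure X y (K r)) (T i)) \<longlonglongrightarrow> integral\<^sup>L \<mu> (T i)" for i
  proof (rule LIM_zero_cancel, rule tendsto_rabs_zero_cancel,
      rule tendsto_sandwich[OF _ _ tendsto_const lim_inverse_n'[THEN LIMSEQ_Suc]])
    have "\<bar>integral\<^sup>L (empirical_measure X y (K r)) (T i) - integral\<^sup>L \<mu> (T i)\<bar> < 1 / real (Suc r)" if "i \<le> r" for r
      using K(2)[of r] that by (auto simp: U_def)
    then show "\<forall>\<^sub>F r in sequentially. \<bar>integral\<^sup>L (empirical_measure X y (K r)) (T i) - integral\<^sup>L \<mu> (T i)\<bar> \<le> 1 / real (Suc r)"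
      by (intro eventually_sequentiallyI[of i] less_imp_le)
  qed auto
  then show ?thesis using K(1) by (auto simp: Suc_le_eq)
qed

text \<open>Helly's selection theorem on the real line, applied to the images of the measures under
  the inclusion of the unit interval; these are tight because they all live on that
  interval.\<close>

lemma ex_convergent_subsequence_unit_interval:
  fixes \<rho> :: "nat \<Rightarrow> real measure"
  assumes \<rho>: "\<And>r. \<rho> r \<in> prob_measures {0..1}"
  shows "\<exists>\<phi> \<pi>. strict_mono \<phi> \<and> \<pi> \<in> prob_measures {0..1} \<and>
    (\<forall>f :: real \<Rightarrow> real. continuous_on {0..1} f \<longrightarrow> (\<lambda>r. integral\<^sup>L (\<rho> (\<phi> r)) f) \<longlonglongrightarrow> integral\<^sup>L \<pi> f)"
proof -
  define \<nu> where "\<nu> r = distr (\<rho> r) borel (\<lambda>x. x)" for r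
  have id: "(\<lambda>x. x) \<in> \<rho> r \<rightarrow>\<^sub>M borel" for r
    using measurable_restrict_space1[of "\<lambda>x. x" borel borel "{0..1::real}"]
    by (simp add: measurable_cong_sets[OF prob_measuresD(2)[OF \<rho>] refl])
  have \<nu>: "real_distribution (\<nu> r)" for r
    unfolding \<nu>_def using prob_measuresD[OF \<rho>[of r]] id
    by (auto simp: real_distribution_def real_distribution_axioms_def intro!: prob_space.prob_space_distr)
  \<comment> \<open>Tightness is stated with intervals open on the left, so the left end point must
    be negative in order to include 0.\<close>
  have one: "measure (\<nu> r) {-1<..1} = 1" for r
  proof -
    have "{-1<..1} \<inter> {0..1::real} = {0..1}" by auto
    then have "measure (\<nu> r) {-1<..1} = measure (\<rho> r) (space (\<rho> r))"
      unfolding \<nu>_def using prob_measuresD(3)[OF \<rho>[of r]] by (subst measure_distr[OF id]) auto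
    then show ?thesis using prob_space.prob_space[OF prob_measuresD(1)[OF \<rho>]] by simp
  qed
  have "tight \<nu>"
    unfolding tight_def using \<nu> one by (intro conjI allI impI exI[of _ "-1"] exI[of _ 1]) simp_all
  from tight_imp_convergent_subsubsequence[OF this strict_mono_id]
  obtain \<phi> \<nu>' where \<phi>: "strict_mono \<phi>" "real_distribution \<nu>'" "weak_conv_m (\<nu> \<circ> \<phi>) \<nu>'"
    by (auto simp: comp_def)
  interpret \<nu>': real_distribution \<nu>' by fact
  \<comment> \<open>The retraction of the line onto the unit interval serves twice: it carries the
    limit back to that interval, with no need to locate the support of \<open>\<nu>'\<close>, and it
    extends \<open>f\<close> to a bounded continuous function on the line.\<close>
  define clamp :: "real \<Rightarrow> real" where "clamp t = max 0 (min 1 t)" for t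
  have clamp: "clamp \<in> borel \<rightarrow>\<^sub>M borel_on {0..1}"
    unfolding clamp_def by (intro measurable_restrict_space2) auto
  then have clamp': "clamp \<in> \<nu>' \<rightarrow>\<^sub>M borel_on {0..1}"
    by (simp add: measurable_cong_sets[OF \<nu>'.events_eq_borel refl])
  define \<pi> where "\<pi> = distr \<nu>' (borel_on {0..1}) clamp"
  have "\<pi> \<in> prob_measures {0..1}"
    unfolding \<pi>_def prob_measures_def using clamp' by (auto intro!: \<nu>'.prob_space_distr)
  moreover have "(\<lambda>r. integral\<^sup>L (\<rho> (\<phi> r)) f) \<longlonglongrightarrow> integral\<^sup>L \<pi> f"
    if f: "continuous_on {0..1} f" for f :: "real \<Rightarrow> real"
  proof -
    have f_meas: "f \<in> borel_measurable (borel_on {0..1})"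
      by (rule borel_measurable_continuous_on_restrict[OF f])
    have cont: "continuous_on UNIV (\<lambda>t. f (clamp t))"
      by (rule continuous_on_compose2[OF f]) (auto simp: clamp_def intro!: continuous_intros)
    have "bounded (f ` {0..1})"
      using compact_continuous_image[OF f] by (simp add: compact_imp_bounded)
    then obtain b where b: "\<And>t. t \<in> {0..1} \<Longrightarrow> norm (f t) \<le> b" unfolding bounded_iff by blast
    have "(\<lambda>r. integral\<^sup>L ((\<nu> \<circ> \<phi>) r) (\<lambda>t. f (clamp t))) \<longlonglongrightarrow> integral\<^sup>L \<nu>' (\<lambda>t. f (clamp t))"
      using \<phi> \<nu> cont b by (intro weak_conv_imp_integral_bdd_continuous_conv[of _ _ _ b])
        (auto simp: continuous_on_eq_continuous_at clamp_def comp_def)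
    moreover have "integral\<^sup>L (\<nu> r) (\<lambda>t. f (clamp t)) = integral\<^sup>L (\<rho> r) f" for r
      unfolding \<nu>_def using borel_measurable_continuous_onI[OF cont] prob_measuresD(3)[OF \<rho>[of r]]
      by (subst integral_distr[OF id]) (auto simp: clamp_def intro!: Bochner_Integration.integral_cong)
    moreover have "integral\<^sup>L \<nu>' (\<lambda>t. f (clamp t)) = integral\<^sup>L \<pi> f"
      unfolding \<pi>_def by (rule integral_distr[OF clamp' f_meas, symmetric])
    ultimately show ?thesis by (simp add: comp_def)
  qed
  ultimately show ?thesis using \<phi>(1) by blast
qed

section \<open>Test functions\<close>

text \<open>The triangle inequality through a nearby point of \<open>A\<close>, followed by the
  infimum over \<open>B\<close>. Used in both directions, it compares the distances to two sets that
  are close in the Hausdorff sense.\<close>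

lemma infdist_le_infdist_add:
  assumes "A \<noteq> {}" and "\<And>b. b \<in> B \<Longrightarrow> \<exists>a\<in>A. dist a b \<le> d" and "B \<noteq> {}"
  shows "infdist x A \<le> infdist x B + d"
proof -
  have "infdist x A - d \<le> dist x b" if "b \<in> B" for b
  proof -
    obtain a where "a \<in> A" "dist a b \<le> d" using assms(2)[OF \<open>b \<in> B\<close>] by blast
    then show ?thesis
      using infdist_le[of a A x] dist_triangle[of x a b] by (simp add: dist_commute)
  qed
  then have "infdist x A - d \<le> infdist x B"
    unfolding infdist_notempty[OF \<open>B \<noteq> {}\<close>] using \<open>B \<noteq> {}\<close> by (intro cINF_greatest)
  then show ?thesis by simp
qed

text \<open>For closed \<open>C\<close> the functions
  \<open>max 0 (1 - real k * infdist x C)\<close> decrease to the indicator of \<open>C\<close> as k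
  grows, but there may be uncountably many \<open>C\<close>. By compactness \<open>C\<close> can be
  replaced by a subset of a finite net, and the pairs of such a subset and a slope \<open>k\<close>
  are countable.\<close>

lemma ex_countable_test_functions:
  fixes X :: "'a::metric_space set"
  assumes "compact X"
  shows "\<exists>T :: nat \<Rightarrow> 'a \<Rightarrow> real. (\<forall>i. continuous_on X (T i) \<and> (\<forall>x. 0 \<le> T i x \<and> T i x \<le> 1)) \<and>
    (\<forall>C k e. C \<subseteq> X \<and> C \<noteq> {} \<and> 0 < e \<longrightarrow>
      (\<exists>i. \<forall>x. \<bar>T i x - max 0 (1 - real k * infdist x C)\<bar> \<le> e))"
proof -
  have "\<exists>D. finite D \<and> D \<subseteq> X \<and> X \<subseteq> (\<Union>d\<in>D. ball d (1 / real (Suc l)))" for l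
    using compactE_image[OF assms, of X "\<lambda>d. ball d (1 / real (Suc l))"] by force
  then obtain D where D: "\<And>l. finite (D l)" "\<And>l. X \<subseteq> (\<Union>d\<in>D l. ball d (1 / real (Suc l)))"
    by metis
  define h :: "'a set \<times> nat \<Rightarrow> 'a \<Rightarrow> real" where "h = (\<lambda>(E, k) x. max 0 (1 - real k * infdist x E))"
  define \<E> where "\<E> = (\<Union>l. Pow (D l)) \<times> (UNIV :: nat set)"
  have "countable \<E>" "\<E> \<noteq> {}"
    unfolding \<E>_def using D(1) by (auto intro!: countable_SIGMA countable_UN intro: countable_finite)
  then have range: "range (from_nat_into \<E>) = \<E>" by (simp add: range_from_nat_into)
  define T where "T i = h (from_nat_into \<E> i)" for i
  have "continuous_on X (h p)" for p
    unfolding h_def by (cases p) (auto intro!: continuous_intros)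
  then have "continuous_on X (T i)" for i
    unfolding T_def .
  moreover have "0 \<le> h p x" "h p x \<le> 1" for p x
    unfolding h_def by (cases p; simp add: infdist_nonneg)+
  then have "0 \<le> T i x \<and> T i x \<le> 1" for i x
    unfolding T_def by blast
  moreover have "\<exists>i. \<forall>x. \<bar>T i x - max 0 (1 - real k * infdist x C)\<bar> \<le> e"
    if C: "C \<subseteq> X" "C \<noteq> {}" and "0 < e" for C k e
  proof -
    \<comment> \<open>A change of the set by Hausdorff distance \<open>d\<close> changes the
      function by at most \<open>k * d\<close>, so the net is chosen with \<open>k * d\<close> at
      most \<open>e\<close>.\<close>
    obtain l where l: "(1 + real k) / e < real (Suc l)"
      using reals_Archimedean2[of "(1 + real k) / e"] by (metis lessI less_trans of_nat_less_iff)
    define d where "d = 1 / real (Suc l)"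
    have d: "0 < d" "real k * d \<le> e"
      using l \<open>0 < e\<close> by (auto simp: d_def field_simps)
    \<comment> \<open>The net points close to \<open>C\<close>: each is within \<open>d\<close> of
      \<open>C\<close> by definition, and each point of \<open>C\<close> is within \<open>d\<close>
      of one of them by the covering property.\<close>
    define E where "E = {p \<in> D l. \<exists>c\<in>C. dist p c \<le> d}"
    have near: "\<exists>p\<in>E. dist p c \<le> d" if "c \<in> C" for c
    proof -
      have "c \<in> (\<Union>p\<in>D l. ball p d)" using D(2)[of l] C \<open>c \<in> C\<close> unfolding d_def by blast
      then obtain p where "p \<in> D l" "dist p c < d" by auto
      then show ?thesis using that by (auto simp: E_def intro!: exI[of _ p] bexI[of _ c])
    qed
    then have "E \<noteq> {}" using C by blast
    have "\<bar>infdist x E - infdist x C\<bar> \<le> d" for x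
      using infdist_le_infdist_add[of E C d x] infdist_le_infdist_add[of C E d x] near C \<open>E \<noteq> {}\<close>
      by (auto simp: E_def dist_commute abs_le_iff)
    then have "real k * \<bar>infdist x E - infdist x C\<bar> \<le> e" for x
      using d mult_left_mono[of "\<bar>infdist x E - infdist x C\<bar>" d "real k"] by (meson of_nat_0_le_iff order_trans)
    then have "\<bar>real k * infdist x E - real k * infdist x C\<bar> \<le> e" for x
      by (simp add: abs_mult flip: right_diff_distrib)
    moreover have "\<bar>max 0 (1 - u) - max 0 (1 - v)\<bar> \<le> \<bar>u - v\<bar>" for u v :: real
      by (simp add: max_def abs_if)
    ultimately have "\<bar>h (E, k) x - max 0 (1 - real k * infdist x C)\<bar> \<le> e" for x
      unfolding h_def prod.case by (meson order_trans)
    moreover have "(E, k) \<in> \<E>" by (auto simp: \<E>_def E_def)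
    then obtain i where "from_nat_into \<E> i = (E, k)" using range by (metis imageE)
    ultimately show ?thesis by (auto simp: T_def intro!: exI[of _ i])
  qed
  ultimately show ?thesis by (intro exI[of _ T] conjI allI impI) simp_all
qed

text \<open>A steep function \<open>h k\<close> has \<open>lam\<close>-integral close to
  \<open>measure lam C\<close>, and some \<open>T i\<close> is uniformly close to
  \<open>h k\<close>. The hypothesis \<open>bound\<close> then applies to \<open>T i\<close>, while
  \<open>h k\<close>, and hence \<open>T i\<close> up to an error \<open>e\<close>, dominates the
  indicator of \<open>C\<close>.\<close>

lemma closed_bound_from_test_functions:
  fixes X :: "'a::metric_space set" and T :: "nat \<Rightarrow> 'a \<Rightarrow> real"
  assumes lam: "lam \<in> prob_measures X" and \<mu>: "\<mu> \<in> prob_measures X"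
    and T: "\<And>i. continuous_on X (T i)" "\<And>i x. 0 \<le> T i x" "\<And>i x. T i x \<le> 1"
    and approx: "\<And>C k e. C \<subseteq> X \<Longrightarrow> C \<noteq> {} \<Longrightarrow> 0 < e \<Longrightarrow>
      \<exists>i. \<forall>x. \<bar>T i x - max 0 (1 - real k * infdist x C)\<bar> \<le> e"
    and bound: "\<And>i. integral\<^sup>L lam (T i) < s \<Longrightarrow> integral\<^sup>L \<mu> (T i) \<le> v"
    and C: "closed C" "C \<subseteq> X" "C \<noteq> {}" and less: "measure lam C < s"
  shows "measure \<mu> C \<le> v"
proof (rule field_le_epsilon)
  fix e' :: real assume "0 < e'"
  \<comment> \<open>Two errors \<open>e\<close> must fit between \<open>measure lam C\<close> and
    \<open>s\<close>: one from the choice of \<open>k\<close>, one from replacing \<open>h k\<close>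
    by \<open>T i\<close>. The latter reappears as the final loss, whence the bound by
    \<open>e'\<close>.\<close>
  define e where "e = min e' ((s - measure lam C) / 2)"
  have e: "0 < e" "e \<le> e'" "measure lam C + 2 * e \<le> s"
    using \<open>0 < e'\<close> less by (auto simp: e_def min_def field_simps)
  define h :: "nat \<Rightarrow> 'a \<Rightarrow> real" where "h k x = max 0 (1 - real k * infdist x C)" for k x
  have h_cont: "continuous_on X (h k)" for k
    unfolding h_def by (intro continuous_intros)
  have h_bounds: "0 \<le> h k x" "h k x \<le> 1" for k x
    unfolding h_def by (auto simp: infdist_nonneg)
  have h_int: "integrable \<nu> (h k)" if "\<nu> \<in> prob_measures X" for \<nu> k
    using h_bounds by (intro integrable_continuous_bounded[OF that h_cont, of _ 1]) auto
  have T_int: "integrable \<nu> (T i)" if "\<nu> \<in> prob_measures X" for \<nu> i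
    using T by (intro integrable_continuous_bounded[OF that, of _ 1]) auto
  have C_sets: "C \<in> sets \<nu>" if "\<nu> \<in> prob_measures X" for \<nu>
    unfolding prob_measuresD(2)[OF that] sets_restrict_space using C by (auto intro!: image_eqI[of _ _ C])
  interpret lam: prob_space lam using prob_measuresD(1)[OF lam] .
  interpret \<mu>: prob_space \<mu> using prob_measuresD(1)[OF \<mu>] .
  have "(\<lambda>k. integral\<^sup>L lam (h k)) \<longlonglongrightarrow> integral\<^sup>L lam (indicator C)"
  proof (rule integral_dominated_convergence[where w = "\<lambda>_. 1"])
    have "(\<lambda>k. h k x) \<longlonglongrightarrow> indicator C x" for x
    proof (cases "x \<in> C")
      case True
      then have "h k x = 1" for k by (simp add: h_def)
      then show ?thesis using True by simp
    next
      case False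
      then have pos: "0 < infdist x C"
        using C in_closed_iff_infdist_zero[of C x] infdist_nonneg[of x C] by linarith
      obtain k0 where k0: "1 / infdist x C < real k0" using reals_Archimedean2 by blast
      have "h k x = 0" if "k0 \<le> k" for k
      proof -
        have "1 \<le> real k0 * infdist x C" using k0 pos by (simp add: field_simps)
        also have "\<dots> \<le> real k * infdist x C" using that pos by (intro mult_right_mono) auto
        finally show ?thesis by (simp add: h_def)
      qed
      then show ?thesis using False by (intro tendsto_eventually eventually_sequentiallyI[of k0]) auto
    qed
    then show "AE x in lam. (\<lambda>k. h k x) \<longlonglongrightarrow> indicator C x" by simp
  qed (use h_bounds C_sets[OF lam] borel_measurable_integrable[OF h_int[OF lam]] in auto)
  then have "(\<lambda>k. integral\<^sup>L lam (h k)) \<longlonglongrightarrow> measure lam C"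
    using C_sets[OF lam] by simp
  then have "\<forall>\<^sub>F k in sequentially. integral\<^sup>L lam (h k) < measure lam C + e"
    using e by (intro order_tendstoD) auto
  then obtain k where k: "integral\<^sup>L lam (h k) < measure lam C + e"
    by (auto simp: eventually_sequentially)
  obtain i where i: "\<And>x. \<bar>T i x - h k x\<bar> \<le> e"
    using approx[OF C(2,3) e(1)] unfolding h_def by blast
  have i': "T i x \<le> h k x + e" "h k x \<le> T i x + e" for x
    using i[of x] by (auto simp: abs_le_iff)
  have "integral\<^sup>L lam (T i) \<le> (\<integral>x. h k x + e \<partial>lam)"
    using i'(1) by (intro integral_mono T_int[OF lam] Bochner_Integration.integrable_add h_int[OF lam]) auto
  also have "\<dots> = integral\<^sup>L lam (h k) + e"
    using h_int[OF lam] by (simp add: lam.prob_space)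
  finally have *: "integral\<^sup>L \<mu> (T i) \<le> v" using k e by (intro bound) simp
  have "measure \<mu> C = integral\<^sup>L \<mu> (indicator C)" using C_sets[OF \<mu>] by simp
  also have "\<dots> \<le> (\<integral>x. T i x + e \<partial>\<mu>)"
  proof (intro integral_mono)
    show "indicator C x \<le> T i x + e" for x
      using i'(2)[of x] e T(2)[of i x] by (cases "x \<in> C") (auto simp: h_def)
  qed (use T_int[OF \<mu>] C_sets[OF \<mu>] in \<open>simp_all add: less_top[symmetric]\<close>)
  also have "\<dots> = integral\<^sup>L \<mu> (T i) + e"
    using T_int[OF \<mu>] by (simp add: \<mu>.prob_space)
  finally show "measure \<mu> C \<le> v + e'" using * e by simp
qed

text \<open>For \<open>0 < s \<le> 1\<close> the integral of \<open>s / max s t\<close> is \<open>F \<pi> s\<close>, but the integrand is continuous in \<open>t\<close>.\<close>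

lemma le_F_if_le_integrals:
  assumes \<pi>: "\<pi> \<in> prob_measures {0..1}" and s: "0 \<le> s" "s \<le> 1"
    and bound: "\<And>s'. s < s' \<Longrightarrow> v \<le> (\<integral>t. s' / max s' t \<partial>\<pi>)"
  shows "v \<le> F \<pi> s"
proof -
  note \<pi>_simps = prob_measuresD[OF \<pi>]
  interpret prob_space \<pi> by (rule \<pi>_simps)
  \<comment> \<open>The bound is available only strictly above \<open>s\<close>, so \<open>s\<close>
    is approached from the right.\<close>
  define u where "u k = s + 1 / real (Suc k)" for k
  have u: "s < u k" "0 < u k" for k using s by (auto simp: u_def intro: add_nonneg_pos)
  have u_lim: "u \<longlonglongrightarrow> s"
    unfolding u_def using tendsto_add[OF tendsto_const lim_inverse_n'[THEN LIMSEQ_Suc], of s] by simp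
  have sets: "{0..s} \<in> sets \<pi>" "{s<..1} \<in> sets \<pi>"
    unfolding \<pi>_simps sets_restrict_space
    using s by (auto intro: image_eqI[of _ _ "{0..s}"] image_eqI[of _ _ "{s<..1}"])
  \<comment> \<open>The pointwise limit of \<open>u k / max (u k) t\<close> on the unit interval: 1
    up to \<open>s\<close> and \<open>s / t\<close> beyond. It is written so that integrating term
    by term gives \<open>F \<pi> s\<close>.\<close>
  define g where "g t = indicator {0..s} t + s * (indicator {s<..1} t * (1 / t))" for t :: real
  have id: "(\<lambda>t. t) \<in> borel_measurable \<pi>"
    using measurable_restrict_space1[of "\<lambda>x. x" borel borel "{0..1::real}"]
    by (simp add: measurable_cong_sets[OF \<pi>_simps(2) refl])
  \<comment> \<open>For \<open>s = 0\<close> the function \<open>1 / t\<close> may fail to be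
    integrable, but the factor \<open>s\<close> annihilates the second term. Otherwise
    \<open>1 / t\<close> is bounded by \<open>1 / s\<close> on the relevant interval.\<close>
  have g_int: "(\<integral>t. g t \<partial>\<pi>) = F \<pi> s"
  proof (cases "s = 0")
    case True
    then show ?thesis using sets by (simp add: g_def F_def)
  next
    case False
    have "integrable \<pi> (\<lambda>t. indicator {s<..1} t * (1 / t))"
    proof (rule integrable_const_bound[of _ "1 / s"])
      show "AE t in \<pi>. norm (indicator {s<..1} t * (1 / t)) \<le> 1 / s"
        using False s by (intro AE_I2) (auto simp: indicator_def intro!: divide_left_mono)
    qed (use id sets in measurable)
    then have "(\<integral>t. g t \<partial>\<pi>) = (\<integral>t. indicator {0..s} t \<partial>\<pi>) + (\<integral>t. s * (indicator {s<..1} t * (1 / t)) \<partial>\<pi>)"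
      unfolding g_def by (intro Bochner_Integration.integral_add integrable_mult_right)
        (simp_all add: less_top[symmetric] sets)
    also have "\<dots> = prob {0..s} + s * (\<integral>t. indicator {s<..1} t * (1 / t) \<partial>\<pi>)"
      by (simp only: integral_mult_right_zero) (simp add: sets)
    finally show ?thesis by (simp add: F_def set_lebesgue_integral_def)
  qed
  have "(\<lambda>k. \<integral>t. u k / max (u k) t \<partial>\<pi>) \<longlonglongrightarrow> (\<integral>t. g t \<partial>\<pi>)"
  proof (rule integral_dominated_convergence[where w = "\<lambda>_. 1"])
    have "(\<lambda>k. u k / max (u k) t) \<longlonglongrightarrow> g t" if t: "t \<in> {0..1}" for t
    proof (cases "t \<le> s")
      case True
      then have "u k / max (u k) t = 1" for k using u[of k] by (simp add: max_def)
      moreover have "g t = 1" using True t by (simp add: g_def)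
      ultimately show ?thesis by (simp only: tendsto_const)
    next
      case False
      then have "(\<lambda>k. u k / max (u k) t) \<longlonglongrightarrow> s / max s t"
        using s by (intro tendsto_intros u_lim) auto
      then show ?thesis using False t by (simp add: g_def max_def)
    qed
    then show "AE t in \<pi>. (\<lambda>k. u k / max (u k) t) \<longlonglongrightarrow> g t"
      using \<pi>_simps(3) by (intro AE_I2) auto
    show "AE t in \<pi>. norm (u k / max (u k) t) \<le> 1" for k
      using u(2)[of k] by (intro AE_I2) (auto simp: abs_div_pos max_def divide_simps)
    show "g \<in> borel_measurable \<pi>"
      unfolding g_def using id sets by measurable
    show "(\<lambda>t. u k / max (u k) t) \<in> borel_measurable \<pi>" for k
      using id by measurable
  qed simp
  then show ?thesis
    unfolding g_int using bound u(1) by (intro LIMSEQ_le_const) auto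
qed

section \<open>Sums over blocks\<close>

lemma sum_over_blocks:
  fixes g :: "nat \<Rightarrow> 'b::comm_monoid_add"
  assumes "interval_partition a"
  shows "(\<Sum>i\<in>R \<inter> {1..a N}. g i) = (\<Sum>j=1..N. \<Sum>i\<in>R \<inter> block a j. g i)"
proof (induction N)
  case 0
  then show ?case using assms by (simp add: interval_partition_def)
next
  case (Suc N)
  have "a N < a (Suc N)" using assms by (auto simp: interval_partition_def strict_mono_def)
  then have "R \<inter> {1..a (Suc N)} = R \<inter> {1..a N} \<union> R \<inter> block a (Suc N)"
    by (auto simp: block_def)
  moreover have "finite (R \<inter> block a (Suc N))"
    by (rule finite_subset[of _ "{..a (Suc N)}"]) (auto simp: block_def)
  ultimately have "(\<Sum>i\<in>R \<inter> {1..a (Suc N)}. g i)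
      = (\<Sum>i\<in>R \<inter> {1..a N}. g i) + (\<Sum>i\<in>R \<inter> block a (Suc N). g i)"
    by (simp only:) (rule sum.union_disjoint, auto simp: block_def)
  then show ?case using Suc.IH by simp
qed

section \<open>Counting the members of a prescribed sequence\<close>

lemma card_members_eq_total:
  assumes "interval_partition a" and "n \<in> prescribed_seqs a m"
  shows "card (n ` {1..} \<inter> {1..a N}) = total m N"
proof -
  have "card (n ` {1..} \<inter> {1..a N}) = (\<Sum>j=1..N. card (n ` {1..} \<inter> block a j))"
    using sum_over_blocks[OF assms(1), of "\<lambda>_. 1 :: nat"] by (simp del: One_nat_def)
  then show ?thesis
    using assms(2) by (simp add: prescribed_seqs_def total_def)
qed

lemma prescribed_seqsD:
  assumes "n \<in> prescribed_seqs a m"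
  shows "strict_mono_on {1..} n" "1 \<le> k \<Longrightarrow> 1 \<le> n k" "1 \<le> j \<Longrightarrow> card (n ` {1..} \<inter> block a j) = m j"
  using assms by (auto simp: prescribed_seqs_def increasing_index_seqs_def)

text \<open>Since \<open>n\<close> is strictly increasing, \<open>n K\<close> is its K-th member,
  and \<open>total m N\<close> counts the members up to \<open>a N\<close>.\<close>

lemma le_total_iff:
  assumes "interval_partition a" and n: "n \<in> prescribed_seqs a m" and "1 \<le> K"
  shows "K \<le> total m N \<longleftrightarrow> n K \<le> a N"
proof
  note n' = prescribed_seqsD[OF n]
  have inj: "inj_on n {1..}" using n'(1) by (rule strict_mono_on_imp_inj_on)
  {
    assume "n K \<le> a N"
    then have "n k \<le> a N" if "k \<in> {1..K}" for k
      using strict_mono_on_leD[OF n'(1), of k K] that \<open>1 \<le> K\<close> by auto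
    then have "n ` {1..K} \<subseteq> n ` {1..} \<inter> {1..a N}"
      using n'(2) by auto
    then have "card (n ` {1..K}) \<le> total m N"
      unfolding card_members_eq_total[OF assms(1,2), symmetric] by (intro card_mono) auto
    then show "K \<le> total m N"
      using card_image[OF inj_on_subset[OF inj, of "{1..K}"]] by auto
  }
  assume "K \<le> total m N"
  show "n K \<le> a N"
  proof (rule ccontr)
    assume "\<not> n K \<le> a N"
    then have "k < K" if "1 \<le> k" "n k \<le> a N" for k
      using strict_mono_on_leD[OF n'(1), of K k] that \<open>1 \<le> K\<close> by (cases "k < K") auto
    then have "n ` {1..} \<inter> {1..a N} \<subseteq> n ` {1..<K}" by auto
    then have "total m N \<le> card (n ` {1..<K})"
      unfolding card_members_eq_total[OF assms(1,2), symmetric] by (intro card_mono) auto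
    also have "\<dots> \<le> K - 1" using card_image_le[of "{1..<K}" n] by simp
    finally show False using \<open>K \<le> total m N\<close> \<open>1 \<le> K\<close> by simp
  qed
qed

text \<open>The first \<open>K\<close> members lie in the first \<open>N\<close> blocks; adding the
  remaining members of these blocks cannot decrease the sum of a nonnegative function.\<close>

lemma sum_along_subsequence_le:
  fixes g :: "nat \<Rightarrow> real"
  assumes "interval_partition a" and n: "n \<in> prescribed_seqs a m" and "K \<le> total m N"
    and nonneg: "\<And>i. 1 \<le> i \<Longrightarrow> 0 \<le> g i"
  shows "(\<Sum>k=1..K. g (n k)) \<le> (\<Sum>j=1..N. \<Sum>i\<in>n ` {1..} \<inter> block a j. g i)"
proof -
  have inj: "inj_on n {1..K}"
    using strict_mono_on_imp_inj_on[OF prescribed_seqsD(1)[OF n]] by (rule inj_on_subset) auto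
  have "n k \<in> n ` {1..} \<inter> {1..a N}" if "k \<in> {1..K}" for k
    using le_total_iff[OF assms(1,2), of k N] that assms(3) prescribed_seqsD(2)[OF n, of k] by auto
  then have "n ` {1..K} \<subseteq> n ` {1..} \<inter> {1..a N}" by blast
  then have "(\<Sum>i\<in>n ` {1..K}. g i) \<le> (\<Sum>i\<in>n ` {1..} \<inter> {1..a N}. g i)"
    using nonneg by (intro sum_mono2) auto
  then show ?thesis
    by (simp only: sum_over_blocks[OF assms(1)] sum.reindex[OF inj] comp_def)
qed

section \<open>Well distribution and the estimate block by block\<close>

lemma integral_empirical_measure:
  fixes f :: "'a::topological_space \<Rightarrow> real"
  assumes "continuous_on X f" and "\<And>i. 1 \<le> i \<Longrightarrow> x i \<in> X"
  shows "integral\<^sup>L (empirical_measure X x N) f = (\<Sum>i=1..N. f (x i)) / real N"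
  unfolding empirical_measure_def using assms
  by (subst integral_dirac_combination) (auto simp: sum_divide_distrib)

text \<open>The uniformity in \<open>k\<close> is the point: one threshold for the length serves all
  blocks, wherever they begin.\<close>

lemma well_distributed_sum_le:
  fixes f :: "'a::topological_space \<Rightarrow> real"
  assumes wd: "well_distributed X x lam" and lam: "lam \<in> prob_measures X"
    and x: "\<And>i. 1 \<le> i \<Longrightarrow> x i \<in> X"
    and f: "continuous_on X f" "bounded (f ` X)" and s: "integral\<^sup>L lam f < s"
  shows "\<exists>N\<^sub>0. \<forall>N\<ge>N\<^sub>0. \<forall>k\<ge>1. (\<Sum>i=1..N. f (x (i + k))) \<le> real N * s"
proof -
  let ?U = "{\<mu> \<in> prob_measures X. \<bar>integral\<^sup>L \<mu> f - integral\<^sup>L lam f\<bar> < s - integral\<^sup>L lam f}"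
  have shift: "(shift ^^ k) x = (\<lambda>i. x (i + k))" for k
    by (induction k) (auto simp: shift_def)
  have "openin (weak_topology X) ?U" by (rule openin_weak_topology_ball[OF f])
  then obtain N\<^sub>0 where N\<^sub>0: "\<And>N k. N\<^sub>0 \<le> N \<Longrightarrow> 1 \<le> k \<Longrightarrow> empirical_measure X ((shift ^^ k) x) N \<in> ?U"
    using wd lam s unfolding well_distributed_def by (metis (no_types, lifting) abs_zero diff_gt_0_iff_gt diff_self mem_Collect_eq)
  have "(\<Sum>i=1..N. f (x (i + k))) \<le> real N * s" if "N\<^sub>0 \<le> N" "1 \<le> k" for N k
  \<comment> \<open>The threshold may be 0; then the mean is a division by zero, but both sides of
    the claim vanish.\<close>
  proof (cases "N = 0")
    case False
    have "(\<Sum>i=1..N. f (x (i + k))) / real N < s"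
      using N\<^sub>0[OF that] x integral_empirical_measure[OF f(1), of "\<lambda>i. x (i + k)" N]
      by (simp add: shift abs_less_iff)
    then show ?thesis using False by (simp add: divide_simps mult.commute)
  qed simp
  then show ?thesis by blast
qed

lemma sum_block_shift:
  fixes g :: "nat \<Rightarrow> real"
  assumes "interval_partition a" and "1 \<le> j"
  shows "(\<Sum>i\<in>block a j. g i) = (\<Sum>i=1..block_length a j. g (i + a (j - 1)))"
proof -
  have "a (j - 1) < a j" using assms by (auto simp: interval_partition_def strict_mono_def)
  then have "block a j = (\<lambda>i. i + a (j - 1)) ` {1..block_length a j}"
    by (auto simp: block_def block_length_def image_iff intro!: bexI[of _ "_ - a (j - 1)"])
  then show ?thesis by (simp only:) (subst sum.reindex, auto simp: inj_on_def)
qed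

text \<open>The weight \<open>s / max s q\<close> equals \<open>min 1 (s / q)\<close> for positive
  q, in a form that is also correct at q = 0. The constant \<open>c\<close> pays for the finitely
  many early blocks in which well distribution gives nothing yet; as it depends on neither
  \<open>K\<close> nor \<open>N\<close>, it disappears after division by the total.\<close>

lemma sum_subsequence_bound:
  fixes f :: "'a::topological_space \<Rightarrow> real"
  assumes adm: "admissible a m" and n: "n \<in> prescribed_seqs a m"
    and wd: "well_distributed X x lam" and lam: "lam \<in> prob_measures X"
    and x: "\<And>i. 1 \<le> i \<Longrightarrow> x i \<in> X"
    and f: "continuous_on X f" "\<And>y. y \<in> X \<Longrightarrow> 0 \<le> f y" "\<And>y. y \<in> X \<Longrightarrow> f y \<le> 1"
    and s: "integral\<^sup>L lam f < s" "0 < s"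
  shows "\<exists>c. \<forall>K N. K \<le> total m N \<longrightarrow>
    (\<Sum>k=1..K. f (x (n k))) \<le> c + (\<Sum>j=1..N. real (m j) * (s / max s (ratio a m j)))"
proof -
  have part: "interval_partition a" and m_le: "\<And>j. 1 \<le> j \<Longrightarrow> m j \<le> block_length a j"
    and len: "filterlim (block_length a) at_top sequentially"
    using adm by (auto simp: admissible_def)
  have "bounded (f ` X)" using f(2,3) by (auto simp: bounded_iff intro!: exI[of _ 1])
  from well_distributed_sum_le[OF wd lam x f(1) this s(1)]
  obtain N\<^sub>0 where N\<^sub>0: "\<And>N k. N\<^sub>0 \<le> N \<Longrightarrow> 1 \<le> k \<Longrightarrow> (\<Sum>i=1..N. f (x (i + k))) \<le> real N * s" by blast
  obtain J where J: "\<And>j. J \<le> j \<Longrightarrow> N\<^sub>0 \<le> block_length a j"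
    using len unfolding filterlim_at_top eventually_sequentially by blast
  \<comment> \<open>Well distribution covers shifts by at least 1 only, which excludes the first
    block because \<open>a 0 = 0\<close>. Beyond \<open>J'\<close> the shift
    \<open>a (j - 1)\<close> is positive.\<close>
  define J' where "J' = max J 1"
  let ?R = "n ` {1..}"
  have mem: "1 \<le> i" if "i \<in> ?R" for i using that prescribed_seqsD(2)[OF n] by auto
  have card_bound: "(\<Sum>i\<in>?R \<inter> block a j. f (x i)) \<le> real (m j)" if "1 \<le> j" for j
  proof -
    have "(\<Sum>i\<in>?R \<inter> block a j. f (x i)) \<le> (\<Sum>i\<in>?R \<inter> block a j. 1)"
      using f(3) x mem by (intro sum_mono) auto
    then show ?thesis using prescribed_seqsD(3)[OF n that] by simp
  qed
  have block_bound: "(\<Sum>i\<in>?R \<inter> block a j. f (x i)) \<le> real (m j) * (s / max s (ratio a m j))" if "J' < j" for j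
  proof (cases "ratio a m j \<le> s")
    case True
    then show ?thesis using card_bound[of j] that s(2) by (simp add: J'_def max_def)
  next
    case False
    then have pos: "0 < m j" "0 < block_length a j" using s(2)
      by (auto simp: ratio_def intro!: Nat.gr0I)
    have "1 \<le> a (j - 1)"
      using part that strict_mono_less[of a 0 "j - 1"] by (auto simp: interval_partition_def J'_def)
    have "(\<Sum>i\<in>?R \<inter> block a j. f (x i)) \<le> (\<Sum>i\<in>block a j. f (x i))"
      using f(2) x by (intro sum_mono2) (auto simp: block_def intro: finite_subset[of _ "{..a j}"])
    also have "\<dots> = (\<Sum>i=1..block_length a j. f (x (i + a (j - 1))))"
      using part that by (intro sum_block_shift) (auto simp: J'_def)
    also have "\<dots> \<le> real (block_length a j) * s"
      using J[of j] that \<open>1 \<le> a (j - 1)\<close> by (intro N\<^sub>0) (auto simp: J'_def)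
    \<comment> \<open>Here the maximum is the ratio \<open>m j / block_length a j\<close>, so
      \<open>m j\<close> cancels.\<close>
    also have "\<dots> = real (m j) * (s / max s (ratio a m j))"
      using False pos by (simp add: max_def ratio_def)
    finally show ?thesis .
  qed
  have weight_nonneg: "0 \<le> real (m j) * (s / max s (ratio a m j))" for j
    using s(2) by (auto simp: max_def ratio_def)
  have "(\<Sum>k=1..K. f (x (n k))) \<le> real (total m J') + (\<Sum>j=1..N. real (m j) * (s / max s (ratio a m j)))"
    if "K \<le> total m N" for K N
  proof -
    have "(\<Sum>k=1..K. f (x (n k))) \<le> (\<Sum>j=1..N. \<Sum>i\<in>?R \<inter> block a j. f (x i))"
      using f(2) x by (intro sum_along_subsequence_le[OF part n that]) auto
    \<comment> \<open>Blocks up to \<open>J'\<close> are charged with the trivial bound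
      \<open>m j\<close> in addition to their nonnegative weight.\<close>
    also have "\<dots> \<le> (\<Sum>j=1..N. (if j \<le> J' then real (m j) else 0) + real (m j) * (s / max s (ratio a m j)))"
    proof (rule sum_mono)
      fix j assume "j \<in> {1..N}"
      then show "(\<Sum>i\<in>?R \<inter> block a j. f (x i)) \<le>
          (if j \<le> J' then real (m j) else 0) + real (m j) * (s / max s (ratio a m j))"
        using card_bound[of j] block_bound[of j] weight_nonneg[of j] by (cases "j \<le> J'") auto
    qed
    also have "\<dots> = (\<Sum>j\<in>{1..N} \<inter> {..J'}. real (m j)) + (\<Sum>j=1..N. real (m j) * (s / max s (ratio a m j)))"
      by (simp only: sum.distrib sum.inter_restrict finite_atLeastAtMost atMost_iff)
    also have "(\<Sum>j\<in>{1..N} \<inter> {..J'}. real (m j)) \<le> real (total m J')"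
      unfolding total_def of_nat_sum by (rule sum_mono2) auto
    finally show ?thesis by simp
  qed
  then show ?thesis by blast
qed

section \<open>The ratio measures\<close>

lemma ratio_in_unit_interval:
  assumes "admissible a m" and "1 \<le> j"
  shows "ratio a m j \<in> {0..1}"
  using assms by (auto simp: admissible_def ratio_def divide_le_eq_1)

lemma ratio_measure_in_prob_measures:
  assumes "admissible a m" and "0 < total m N"
  shows "ratio_measure a m N \<in> prob_measures {0..1}"
proof -
  have "(\<Sum>j=1..N. real (m j) / real (total m N)) = real (total m N) / real (total m N)"
    by (simp only: total_def of_nat_sum sum_divide_distrib)
  then have "(\<Sum>j=1..N. real (m j) / real (total m N)) = 1"
    using assms(2) by simp
  then show ?thesis
    unfolding ratio_measure_def using ratio_in_unit_interval[OF assms(1)]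
    by (intro dirac_combination_in_prob_measures) auto
qed

lemma integral_ratio_measure:
  fixes f :: "real \<Rightarrow> real"
  assumes "admissible a m" and "continuous_on {0..1} f"
  shows "integral\<^sup>L (ratio_measure a m N) f = (\<Sum>j=1..N. real (m j) * f (ratio a m j)) / real (total m N)"
  unfolding ratio_measure_def using assms(2) ratio_in_unit_interval[OF assms(1)]
  by (subst integral_dirac_combination) (auto simp: sum_divide_distrib)

section \<open>Choice of the limit ratio measure and the domination\<close>

theorem theorem3p1:
  fixes X :: "'a::metric_space set" and lam :: "'a measure" and x :: "nat \<Rightarrow> 'a"
    and a m :: "nat \<Rightarrow> nat"
  assumes "compact X"
    and "lam \<in> prob_measures X"
    and "\<forall>n\<ge>1. x n \<in> X"
    and "well_distributed X x lam"
    and "admissible a m"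
  shows "\<forall>n\<in>prescribed_seqs a m.
    limit_measures X (\<lambda>k. x (n k)) \<subseteq> admissible_limit_measures X lam a m"
proof (intro ballI subsetI)
  note lam = assms(2) and wd = assms(4) and adm = assms(5)
  have x: "x i \<in> X" if "1 \<le> i" for i using assms(3) that by blast
  have part: "interval_partition a" and frac: "(\<lambda>n. real (m n) / real (total m n)) \<longlonglongrightarrow> 0"
    using adm by (auto simp: admissible_def)
  fix n \<mu> assume n: "n \<in> prescribed_seqs a m" and \<mu>_lim: "\<mu> \<in> limit_measures X (\<lambda>k. x (n k))"
  have \<mu>: "\<mu> \<in> prob_measures X"
    using \<mu>_lim closure_of_subset_topspace[of "weak_topology X"]
    by (auto simp: limit_measures_def accumulation_points_def topspace_weak_topology)
  have xn: "x (n k) \<in> X" if "1 \<le> k" for k using x prescribed_seqsD(2)[OF n] that by blast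
  from ex_countable_test_functions[OF assms(1)]
  obtain T :: "nat \<Rightarrow> 'a \<Rightarrow> real" where T: "\<And>i. continuous_on X (T i)" "\<And>i x. 0 \<le> T i x" "\<And>i x. T i x \<le> 1"
    and T_approx: "\<And>C k e. C \<subseteq> X \<Longrightarrow> C \<noteq> {} \<Longrightarrow> 0 < e \<Longrightarrow>
      \<exists>i. \<forall>x. \<bar>T i x - max 0 (1 - real k * infdist x C)\<bar> \<le> e"
    by metis
  have "bounded (T i ` X)" for i using T(2,3) by (auto simp: bounded_iff intro!: exI[of _ 1])
  from limit_measures_sequence[of \<mu> X _ T, OF \<mu>_lim T(1) this]
  obtain K where K: "\<And>r. r < K r"
    and K_lim: "\<And>i. (\<lambda>r. integral\<^sup>L (empirical_measure X (\<lambda>k. x (n k)) (K r)) (T i)) \<longlonglongrightarrow> integral\<^sup>L \<mu> (T i)"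
    by blast
  \<comment> \<open>\<open>N r\<close> is the block that contains the member with number
    \<open>K r\<close>. Minimality keeps the overshoot of \<open>total m (N r)\<close> over
    \<open>K r\<close> below \<open>m (N r)\<close>, which is negligible by admissibility.\<close>
  define N where "N r = (LEAST N. K r \<le> total m N)" for r
  \<comment> \<open>Some block index qualifies: \<open>n (K r)\<close> itself, because
    \<open>a\<close> is strictly increasing and so \<open>a i\<close> is at least i.\<close>
  have "K r \<le> total m (n (K r))" for r
    using le_total_iff[OF part n, of "K r" "n (K r)"] K[of r] part strict_mono_imp_increasing[of a "n (K r)"]
    by (auto simp: interval_partition_def)
  then have N: "K r \<le> total m (N r)" for r unfolding N_def by (rule LeastI)
  have total_N_pos: "0 < total m (N r)" for r using N[of r] K[of r] by linarith
  have N_pos: "1 \<le> N r" for r using total_N_pos[of r] by (cases "N r") (auto simp: total_def)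
  have K_gt: "total m (N r) < K r + m (N r)" for r
  proof -
    have "\<not> K r \<le> total m (N r - 1)"
      unfolding N_def by (rule not_less_Least) (use N_pos[of r] in \<open>auto simp: N_def\<close>)
    moreover have "total m (N r) = total m (N r - 1) + m (N r)"
      using N_pos[of r] by (cases "N r") (auto simp: total_def)
    ultimately show ?thesis by simp
  qed
  have N_top: "filterlim N at_top sequentially"
    unfolding filterlim_at_top eventually_sequentially
  proof (intro allI exI impI)
    fix L r assume "total m L \<le> r"
    show "L \<le> N r"
    proof (rule ccontr)
      assume "\<not> L \<le> N r"
      then have "total m (N r) \<le> total m L" unfolding total_def by (intro sum_mono2) auto
      then show False using N[of r] K[of r] \<open>total m L \<le> r\<close> by linarith
    qed
  qed
  have "real r \<le> real (total m (N r))" for r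
    using N[of r] K[of r] by linarith
  then have total_top: "filterlim (\<lambda>r. real (total m (N r))) at_top sequentially"
    by (intro filterlim_at_top_mono[OF filterlim_real_sequentially] always_eventually allI)
  define \<rho> where "\<rho> r = ratio_measure a m (N r)" for r
  have \<rho>: "\<rho> r \<in> prob_measures {0..1}" for r
    unfolding \<rho>_def using ratio_measure_in_prob_measures[OF adm total_N_pos] .
  \<comment> \<open>The subsequence and \<open>\<pi>\<close> are fixed before any test function
    \<open>T i\<close> or level \<open>s\<close>, so the same \<open>\<pi>\<close> serves for all of
    them.\<close>
  from ex_convergent_subsequence_unit_interval[of \<rho>, OF this]
  obtain \<phi> \<pi> where \<phi>: "strict_mono \<phi>" and \<pi>: "\<pi> \<in> prob_measures {0..1}"
    and \<pi>_lim: "\<And>f :: real \<Rightarrow> real. continuous_on {0..1} f \<Longrightarrow> (\<lambda>r. integral\<^sup>L (\<rho> (\<phi> r)) f) \<longlonglongrightarrow> integral\<^sup>L \<pi> f"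
    by blast
  have "\<pi> \<in> limit_ratio_measures a m"
    unfolding limit_ratio_measures_def accumulation_points_def in_closure_of topspace_weak_topology
  proof (intro INT_I, unfold in_closure_of topspace_weak_topology, intro conjI allI impI \<pi>)
    fix n\<^sub>0 U assume U: "\<pi> \<in> U \<and> openin (weak_topology {0..1}) U"
    then have "\<forall>\<^sub>F r in sequentially. \<rho> (\<phi> r) \<in> U"
      using \<rho> \<pi>_lim by (intro eventually_in_weak_open[of "{0..1}" U \<pi>]) auto
    moreover have "\<forall>\<^sub>F r in sequentially. n\<^sub>0 \<le> N (\<phi> r)"
      using filterlim_compose[OF N_top filterlim_subseq[OF \<phi>]] by (simp add: filterlim_at_top)
    ultimately have "\<forall>\<^sub>F r in sequentially. \<rho> (\<phi> r) \<in> U \<and> n\<^sub>0 \<le> N (\<phi> r)" by (rule eventually_conj)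
    then obtain r where "\<rho> (\<phi> r) \<in> U" "n\<^sub>0 \<le> N (\<phi> r)"
      by (auto simp: eventually_sequentially)
    then show "\<exists>y. y \<in> ratio_measure a m ` {k \<in> {k. 1 \<le> k \<and> 0 < total m k}. n\<^sub>0 \<le> k} \<and> y \<in> U"
      using N_pos total_N_pos by (auto simp: \<rho>_def)
  qed
  moreover have test_bound: "integral\<^sup>L \<mu> (T i) \<le> (\<integral>t. s / max s t \<partial>\<pi>)"
    if s: "integral\<^sup>L lam (T i) < s" "0 < s" for i s
  proof -
    obtain c where c: "\<And>K N. K \<le> total m N \<Longrightarrow>
        (\<Sum>k=1..K. T i (x (n k))) \<le> c + (\<Sum>j=1..N. real (m j) * (s / max s (ratio a m j)))"
      using sum_subsequence_bound[OF adm n wd lam x T(1) T(2) T(3) s] by blast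
    have cont: "continuous_on {0..1} (\<lambda>t. s / max s t)"
      using s(2) by (intro continuous_intros) auto
    let ?E = "\<lambda>r. integral\<^sup>L (empirical_measure X (\<lambda>k. x (n k)) (K r)) (T i)"
    let ?M = "\<lambda>r. real (total m (N r))"
    \<comment> \<open>The empirical mean is normalised by \<open>K r\<close>, the block sums by the
      total. The factor on the left is a lower bound for the quotient of the two and tends to
      1.\<close>
    have E: "?E r * (1 - real (m (N r)) / ?M r) \<le> c / ?M r + (\<integral>t. s / max s t \<partial>\<rho> r)" for r
    proof -
      have E_eq: "?E r = (\<Sum>k=1..K r. T i (x (n k))) / real (K r)"
        using integral_empirical_measure[OF T(1), of "\<lambda>k. x (n k)"] xn by simp
      then have "0 \<le> ?E r" using T(2) by (simp add: sum_nonneg)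
      have "1 - real (m (N r)) / ?M r = (?M r - real (m (N r))) / ?M r"
        using total_N_pos[of r] by (simp add: diff_divide_distrib)
      also have "\<dots> \<le> real (K r) / ?M r"
        using K_gt[of r] by (intro divide_right_mono) auto
      finally have "1 - real (m (N r)) / ?M r \<le> real (K r) / ?M r" .
      with \<open>0 \<le> ?E r\<close> have "?E r * (1 - real (m (N r)) / ?M r) \<le> ?E r * (real (K r) / ?M r)"
        by (rule mult_left_mono[rotated])
      also have "\<dots> = (\<Sum>k=1..K r. T i (x (n k))) / ?M r"
        unfolding E_eq using K[of r] by simp
      also have "\<dots> \<le> (c + (\<Sum>j=1..N r. real (m j) * (s / max s (ratio a m j)))) / ?M r"
        by (intro divide_right_mono c N) simp
      also have "\<dots> = c / ?M r + (\<integral>t. s / max s t \<partial>\<rho> r)"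
        unfolding \<rho>_def integral_ratio_measure[OF adm cont] by (rule add_divide_distrib)
      finally show ?thesis .
    qed
    have "(\<lambda>r. ?E r * (1 - real (m (N r)) / ?M r)) \<longlonglongrightarrow> integral\<^sup>L \<mu> (T i) * (1 - 0)"
      by (intro tendsto_intros K_lim filterlim_compose[OF frac N_top])
    moreover have "(\<lambda>r. c / ?M r) \<longlonglongrightarrow> 0"
      by (intro tendsto_divide_0[OF tendsto_const] filterlim_at_top_imp_at_infinity total_top)
    \<comment> \<open>The empirical integrals converge along the whole sequence, the integrals
      against \<open>\<rho>\<close> only along \<open>\<phi>\<close>.\<close>
    ultimately have "(\<lambda>r. ?E (\<phi> r) * (1 - real (m (N (\<phi> r))) / ?M (\<phi> r))) \<longlonglongrightarrow> integral\<^sup>L \<mu> (T i) * (1 - 0)"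
      and "(\<lambda>r. c / ?M (\<phi> r)) \<longlonglongrightarrow> 0"
      by (auto intro: filterlim_compose[OF _ filterlim_subseq[OF \<phi>]])
    then have "integral\<^sup>L \<mu> (T i) * (1 - 0) \<le> 0 + (\<integral>t. s / max s t \<partial>\<pi>)"
      using E by (intro LIMSEQ_le[OF _ tendsto_add[OF _ \<pi>_lim[OF cont]]]) blast+
    then show ?thesis by simp
  qed
  moreover have "\<mu> \<in> dominated_measures X \<pi> lam"
    unfolding dominated_measures_def
  proof (intro CollectI conjI ballI \<mu>)
    fix B assume B: "B \<in> sets (borel_on X)"
    interpret lam: prob_space lam using prob_measuresD(1)[OF lam] .
    show "measure \<mu> B \<le> F \<pi> (measure lam B)"
    proof (rule le_F_if_le_integrals[OF \<pi>])
      fix s assume s: "measure lam B < s"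
      have "0 < s" using s measure_nonneg[of lam B] by linarith
      show "measure \<mu> B \<le> (\<integral>t. s / max s t \<partial>\<pi>)"
      proof (rule field_le_epsilon)
        fix e :: real assume "0 < e"
        have "closed X" using assms(1) by (rule compact_imp_closed)
        from ex_closed_inner_approximation[OF \<mu> this B \<open>0 < e\<close>]
        obtain C where C: "closed C" "C \<subseteq> B" "measure \<mu> B < measure \<mu> C + e" by blast
        have "B \<subseteq> X" using sets.sets_into_space[OF B] by (simp add: space_restrict_space)
        have "measure \<mu> C \<le> (\<integral>t. s / max s t \<partial>\<pi>)"
        \<comment> \<open>With \<open>infdist x {} = 0\<close> the test functions attached to the
          empty set would be constantly 1, so this case uses only that the integrand is
          nonnegative.\<close>
        proof (cases "C = {}")
          case True
          then show ?thesis using \<open>0 < s\<close> by (auto intro!: integral_nonneg_AE)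
        next
          case False
          have "measure lam C \<le> measure lam B"
            using B C(2) prob_measuresD(2)[OF lam] by (intro lam.finite_measure_mono) auto
          then show ?thesis
            using C \<open>B \<subseteq> X\<close> False s \<open>0 < s\<close> test_bound
            by (intro closed_bound_from_test_functions[OF lam \<mu> T T_approx, of s]) auto
        qed
        then show "measure \<mu> B \<le> (\<integral>t. s / max s t \<partial>\<pi>) + e" using C(3) by simp
      qed
    qed auto
  qed
  ultimately show "\<mu> \<in> admissible_limit_measures X lam a m"
    by (auto simp: admissible_limit_measures_def)
qed

end
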